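(* Let $A\in\mathbb{R}^{m\times 2m}$, $b\in\mathbb{R}^m$, $q\in\mathbb{R}^{2m}$, $a_0\in\mathbb{R}$, $\alpha>0$, and define for $\lambda=(\lambda_1,\dots,\lambda_m)^T\in\mathbb{R}^{2m}$, $\lambda_i\in\mathbb{R}^2$, $$f(\lambda)=\tfrac12\|A\lambda-b\|^2+\langle q,\lambda\rangle+a_0+\sum_{i=1}^m\mathcal{I}_{\mathbb{B}_\alpha(0)}(\lambda_i),$$ where $\mathbb{B}_\alpha(0)=\{x\in\mathbb{R}^2:|x|\le\alpha\}$ is the closed Euclidean ball. Suppose the problem $\min_\lambda f(\lambda)$ has at least one solution $\bar\lambda$ satisfying the following assumption: with $\bar g=A^T(A\bar\lambda-b)+q=(\bar g_1,\dots,\bar g_m)^T$, $\bar g_i\in\mathbb{R}^2$, for every $i=1,\dots,m$ either (i) $\bar\lambda_i\in\mathrm{bd}\,\mathbb{B}_\alpha(0)$, and $\bar g_i\neq0$ with $-\bar g_i\in\mathcal{N}_{\mathbb{B}_\alpha(0)}(\bar\lambda_i)$; or (ii) $\bar\lambda_i\in\mathrm{int}\,\mathbb{B}_\alpha(0)$. Then $\partial f$ is metrically subregular at $\bar\lambda$ for the origin.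
   Context: $\mathcal{I}_C$ denotes the indicator function of a convex set $C$ ($0$ on $C$, $+\infty$ outside), $\mathcal{N}_C(x)=\partial\mathcal{I}_C(x)$ the normal cone, $\mathrm{bd}$ and $\mathrm{int}$ boundary and interior, $|\cdot|$ and $\|\cdot\|$ Euclidean norms, and $\partial f$ the convex subdifferential. Metric subregularity: a set-valued map $F:X\rightrightarrows Y$ is metrically subregular at $\bar x$ for $\bar y$ if $\bar y\in F(\bar x)$ and there exist a modulus $\kappa\ge0$ and neighborhoods $U$ of $\bar x$ and $V$ of $\bar y$ such that $\mathrm{dist}(x,F^{-1}(\bar y))\le\kappa\,\mathrm{dist}(\bar y,F(x)\cap V)$ for all $x\in U$ (with $\mathrm{dist}(\cdot,\emptyset)=+\infty$). *)

theory Defs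
  imports "HOL-Analysis.Analysis"
begin

definition indicator_fun :: "'a set \<Rightarrow> 'a \<Rightarrow> ereal" where
  "indicator_fun C x = (if x \<in> C then 0 else \<infinity>)"

(* Subgradients of convex analysis, with the usual convention that there are none
   outside the effective domain of f. *)
definition subdifferential :: "('a::real_inner \<Rightarrow> ereal) \<Rightarrow> 'a \<Rightarrow> 'a set" where
  "subdifferential f x =
     {v. \<bar>f x\<bar> \<noteq> \<infinity> \<and> (\<forall>y. f x + ereal (v \<bullet> (y - x)) \<le> f y)}"

definition normal_cone :: "'a::real_inner set \<Rightarrow> 'a \<Rightarrow> 'a set" where
  "normal_cone C x = subdifferential (indicator_fun C) x"

(* Extended-real distance to a set: unlike infdist, it is \<infinity> (and not 0) for the empty set. *)
definition set_dist :: "'a::metric_space \<Rightarrow> 'a set \<Rightarrow> ereal" where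
  "set_dist x S = (INF y\<in>S. ereal (dist x y))"

(* A neighbourhood of a point is any set having that point in its interior.  The ereal
   convention 0 * \<infinity> = 0 is harmless: if the bound holds with \<kappa> = 0 under the
   convention 0 * \<infinity> = \<infinity>, then it holds with \<kappa> = 1. *)
definition metrically_subregular ::
    "('a::metric_space \<Rightarrow> 'b::metric_space set) \<Rightarrow> 'a \<Rightarrow> 'b \<Rightarrow> bool" where
  "metrically_subregular F xbar ybar \<longleftrightarrow>
     ybar \<in> F xbar \<and>
     (\<exists>\<kappa>::real. \<kappa> \<ge> 0 \<and> (\<exists>U V. xbar \<in> interior U \<and> ybar \<in> interior V \<and>
        (\<forall>x\<in>U. set_dist x {x'. ybar \<in> F x'} \<le> ereal \<kappa> * set_dist ybar (F x \<inter> V))))"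

(* With m = CARD('m), the coordinates of R^(2m) are indexed by 'm \<times> 2: the coordinate (i, j)
   is the j-th component of the i-th block, which lies in R^2. *)
definition block :: "real ^ ('m::finite \<times> 2) \<Rightarrow> 'm \<Rightarrow> real ^ 2" where
  "block x i = (\<chi> j. x $ (i, j))"

definition objective ::
    "real ^ ('m::finite \<times> 2) ^ 'm \<Rightarrow> real ^ 'm \<Rightarrow> real ^ ('m \<times> 2) \<Rightarrow> real \<Rightarrow> real \<Rightarrow>
     real ^ ('m \<times> 2) \<Rightarrow> ereal" where
  "objective A b q a0 \<alpha> x =
     ereal (1/2 * (norm (A *v x - b))\<^sup>2 + q \<bullet> x + a0) +
     (\<Sum>i\<in>UNIV. indicator_fun (cball 0 \<alpha>) (block x i))"

end

theory Submission imports Defs begin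

text \<open>
  On the feasible set, \<open>f x - f lbar = |A d|\<^sup>2 / 2 + \<langle>gbar, d\<rangle>\<close> with \<open>d = x - lbar\<close>. Blocks in the
  interior have \<open>gbar\<^sub>i = 0\<close>; on the boundary, the curvature of the ball and \<open>gbar\<^sub>i \<noteq> 0\<close> bound
  \<open>\<langle>gbar\<^sub>i, d\<^sub>i\<rangle>\<close> below by a multiple of \<open>|d\<^sub>i|\<^sup>2\<close>. Hence the growth of \<open>f\<close> dominates \<open>|T d|\<^sup>2\<close> for the
  linear map \<open>T\<close> collecting \<open>A d\<close> and the boundary blocks of \<open>d\<close>, and so also the squared distance
  from \<open>d\<close> to the kernel of \<open>T\<close>. Near \<open>lbar\<close> the points of \<open>lbar + ker T\<close> are minimizers, so \<open>f\<close>
  grows quadratically away from its minimizers, which yields subregularity of the subdifferential.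
\<close>

text \<open>Testing the subgradient inequality of \<open>v\<close> at \<open>x\<close> against the
  minimizer \<open>p\<close> gives c |x - p|^2 \<le> v \<bullet> (x - p) \<le> |v| |x - p|, so every
  subgradient at \<open>x\<close> has norm at least c |x - p|. This yields the modulus 1/c, with the
  whole space as the neighbourhood of 0.\<close>

lemma quadratic_growth_imp_metrically_subregular:
  fixes f :: "'a::real_inner \<Rightarrow> ereal"
  assumes fin: "\<bar>f xbar\<bar> \<noteq> \<infinity>" and min: "\<And>y. f xbar \<le> f y"
    and c: "c > 0" and e: "e > 0"
    and growth: "\<And>x. dist xbar x < e \<Longrightarrow>
      \<exists>p. f p = f xbar \<and> f xbar + ereal (c * (dist x p)\<^sup>2) \<le> f x"
  shows "metrically_subregular (subdifferential f) xbar 0"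
proof -
  have minimizer: "0 \<in> subdifferential f p" if "f p = f xbar" for p
    using that fin min by (simp add: subdifferential_def zero_ereal_def[symmetric])
  have bound: "set_dist x {x'. 0 \<in> subdifferential f x'}
      \<le> ereal (1 / c) * set_dist 0 (subdifferential f x \<inter> UNIV)" if "x \<in> ball xbar e" for x
  proof -
    have "dist xbar x < e" using that by simp
    then obtain p where p: "f p = f xbar" "f xbar + ereal (c * (dist x p)\<^sup>2) \<le> f x"
      using growth by blast
    have "c * dist x p \<le> norm v" if v: "v \<in> subdifferential f x" for v
    proof -
      have "\<bar>f x\<bar> \<noteq> \<infinity>" and "f x + ereal (v \<bullet> (p - x)) \<le> f p"
        using v by (auto simp: subdifferential_def)
      then have "c * (dist x p)\<^sup>2 \<le> v \<bullet> (x - p)"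
        using p fin by (cases "f x"; cases "f xbar") (auto simp: inner_diff_right)
      also have "\<dots> \<le> norm v * dist x p"
        by (simp add: dist_norm norm_cauchy_schwarz)
      finally show ?thesis
        by (cases "dist x p = 0") (auto simp: power2_eq_square)
    qed
    \<comment> \<open>If \<open>x\<close> has no subgradient, the infimum is over the empty set and
      equals \<infinity>, so this bound covers that case too.\<close>
    then have "ereal (c * dist x p) \<le> set_dist 0 (subdifferential f x \<inter> UNIV)"
      unfolding set_dist_def by (intro INF_greatest) auto
    then have "ereal (1 / c) * ereal (c * dist x p)
        \<le> ereal (1 / c) * set_dist 0 (subdifferential f x \<inter> UNIV)"
      using c by (intro ereal_mult_left_mono) auto
    moreover have "set_dist x {x'. 0 \<in> subdifferential f x'} \<le> ereal (dist x p)"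
      unfolding set_dist_def using minimizer[OF p(1)] by (intro INF_lower) auto
    ultimately show ?thesis using c by simp
  qed
  show ?thesis
    unfolding metrically_subregular_def
  proof (intro conjI exI ballI)
    show "0 \<in> subdifferential f xbar" using minimizer by simp
    show "0 \<le> 1 / c" using c by simp
    show "xbar \<in> interior (ball xbar e)" using e by (simp add: interior_open)
    show "0 \<in> interior (UNIV :: 'a set)" by simp
  qed (rule bound)
qed

text \<open>\<open>T\<close> is injective on the orthogonal complement of its kernel, hence bounded
  below there by some \<open>s\<close>; \<open>k\<close> is the orthogonal projection of
  \<open>d\<close> onto the kernel. The bound on \<open>norm k\<close> serves to keep points shifted
  by \<open>k\<close> inside a prescribed neighbourhood.\<close>

lemma linear_error_bound:
  fixes T :: "'a::euclidean_space \<Rightarrow> 'b::euclidean_space"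
  assumes T: "linear T"
  obtains s where "s > 0"
    "\<And>d. \<exists>k. T k = 0 \<and> norm k \<le> norm d \<and> s * norm (d - k) \<le> norm (T d)"
proof -
  let ?K = "{x. T x = 0}"
  have K: "subspace ?K" using T by (rule linear_subspace_kernel)
  have "\<forall>x\<in>?K\<^sup>\<bottom>. T x = 0 \<longrightarrow> x = 0"
    by (auto simp: orthogonal_comp_def orthogonal_def)
  then obtain s where s: "s > 0" "\<forall>x\<in>?K\<^sup>\<bottom>. norm (T x) \<ge> s * norm x"
    using injective_imp_isometric[OF closed_subspace[OF subspace_orthogonal_comp]
        subspace_orthogonal_comp linear_linear[THEN iffD2, OF T]] by blast
  have "\<exists>k. T k = 0 \<and> norm k \<le> norm d \<and> s * norm (d - k) \<le> norm (T d)" for d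
  proof -
    have "d \<in> ?K + ?K\<^sup>\<bottom>" using subspace_sum_orthogonal_comp[OF K] by simp
    then obtain k z where kz: "d = k + z" "k \<in> ?K" and z: "z \<in> ?K\<^sup>\<bottom>"
      by (rule set_plus_elim)
    then have k: "T k = 0" and "orthogonal k z" by (auto simp: orthogonal_comp_def)
    then have "(norm d)\<^sup>2 = (norm k)\<^sup>2 + (norm z)\<^sup>2"
      unfolding kz(1) by (intro norm_add_Pythagorean)
    then have "norm k \<le> norm d" by (simp add: power2_le_imp_le)
    moreover have "T d = T z" unfolding kz(1) using k T by (simp add: linear_add)
    ultimately show ?thesis using k s(2) z kz(1) by (intro exI[of _ k]) auto
  qed
  with s(1) show ?thesis by (rule that)
qed

lemma normal_cone_iff:
  "v \<in> normal_cone C x \<longleftrightarrow> x \<in> C \<and> (\<forall>y\<in>C. v \<bullet> (y - x) \<le> 0)"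
  by (auto simp: normal_cone_def subdifferential_def indicator_fun_def)

text \<open>Normality on the sphere forces g = -(|g| / \<alpha>) z. Then g \<bullet> (x - z) = (|g|
  / \<alpha>) (\<alpha>^2 - z \<bullet> x), and expanding |x - z|^2 with |x| \<le> \<alpha> gives
  the claim, with equality when |x| = \<alpha>.\<close>

lemma normal_cone_cball_growth:
  fixes g z x :: "'a::real_inner"
  assumes n: "- g \<in> normal_cone (cball 0 \<alpha>) z" and z: "norm z = \<alpha>" and x: "norm x \<le> \<alpha>"
    and \<alpha>: "\<alpha> > 0"
  shows "norm g / (2 * \<alpha>) * (norm (x - z))\<^sup>2 \<le> g \<bullet> (x - z)"
proof (cases "g = 0")
  case False
  \<comment> \<open>\<open>y\<close> maximizes the linear form of \<open>- g\<close> over the ball.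
    Testing normality at \<open>y\<close> therefore gives the inequality opposite to Cauchy-Schwarz
    for \<open>- g\<close> and \<open>z\<close>.\<close>
  define y where "y = - (\<alpha> / norm g) *\<^sub>R g"
  have "norm y = \<alpha>" using False \<alpha> by (simp add: y_def)
  then have "(- g) \<bullet> (y - z) \<le> 0" using n by (simp add: normal_cone_iff)
  moreover have "g \<bullet> y = - \<alpha> * norm g"
    using False by (simp add: y_def power2_norm_eq_inner[symmetric] power2_eq_square)
  ultimately have gz1: "\<alpha> * norm g \<le> - (g \<bullet> z)" by (simp add: inner_diff_right)
  have gz2: "- (g \<bullet> z) \<le> \<alpha> * norm g"
    using norm_cauchy_schwarz[of "- g" z] z by (simp add: mult.commute)
  have gz: "g \<bullet> z = - (\<alpha> * norm g)" using gz1 gz2 by simp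
  \<comment> \<open>Equality in Cauchy-Schwarz makes \<open>g\<close> and \<open>z\<close>
    antiparallel; this appears here as a vector of norm zero.\<close>
  have "(norm (norm g *\<^sub>R z + \<alpha> *\<^sub>R g))\<^sup>2
      = (norm g)\<^sup>2 * (norm z)\<^sup>2 + 2 * norm g * \<alpha> * (g \<bullet> z) + \<alpha>\<^sup>2 * (norm g)\<^sup>2"
    by (simp add: power2_norm_eq_inner inner_add_left inner_add_right inner_commute)
      (simp add: algebra_simps power2_eq_square flip: power2_norm_eq_inner)
  also have "\<dots> = 0" unfolding gz z by (simp add: power2_eq_square)
  finally have "norm g *\<^sub>R z = - \<alpha> *\<^sub>R g" by (simp add: eq_neg_iff_add_eq_0)
  then have zx: "norm g * (z \<bullet> x) = - \<alpha> * (g \<bullet> x)"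
    by (metis inner_scaleR_left)
  have "(norm (x - z))\<^sup>2 = (norm x)\<^sup>2 + \<alpha>\<^sup>2 - 2 * (z \<bullet> x)"
    unfolding z[symmetric] power2_norm_eq_inner
    by (simp add: inner_diff_left inner_diff_right inner_commute)
  also have "\<dots> \<le> 2 * \<alpha>\<^sup>2 - 2 * (z \<bullet> x)"
    using x by (simp add: power_mono)
  finally have "norm g * (norm (x - z))\<^sup>2 \<le> norm g * (2 * \<alpha>\<^sup>2 - 2 * (z \<bullet> x))"
    by (intro mult_left_mono) auto
  also have "\<dots> = 2 * \<alpha> * (g \<bullet> (x - z))"
    using zx gz by (simp add: algebra_simps inner_diff_right power2_eq_square)
  finally show ?thesis using \<alpha> by (simp add: field_simps)
qed simp

lemma inner_eq_sum_block: "x \<bullet> y = (\<Sum>i\<in>UNIV. block x i \<bullet> block y i)"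
  by (simp add: inner_vec_def block_def sum.cartesian_product flip: UNIV_Times_UNIV)

lemma block_add: "block (x + y) i = block x i + block y i"
  by (simp add: block_def vec_eq_iff)

lemma block_diff: "block (x - y) i = block x i - block y i"
  by (simp add: block_def vec_eq_iff)

lemma block_scaleR: "block (t *\<^sub>R x) i = t *\<^sub>R block x i"
  by (simp add: block_def vec_eq_iff)

lemma norm_block_le: "norm (block x i) \<le> norm x"
proof (rule power2_le_imp_le)
  show "(norm (block x i))\<^sup>2 \<le> (norm x)\<^sup>2"
    unfolding power2_norm_eq_inner inner_eq_sum_block[of x]
    by (rule member_le_sum) auto
qed simp

definition feasible :: "real \<Rightarrow> (real ^ ('m::finite \<times> 2)) set" where
  "feasible \<alpha> = {x. \<forall>i. norm (block x i) \<le> \<alpha>}"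

definition quadratic ::
    "real ^ ('m::finite \<times> 2) ^ 'm \<Rightarrow> real ^ 'm \<Rightarrow> real ^ ('m \<times> 2) \<Rightarrow> real \<Rightarrow>
     real ^ ('m \<times> 2) \<Rightarrow> real" where
  "quadratic A b q a0 x = 1/2 * (norm (A *v x - b))\<^sup>2 + q \<bullet> x + a0"

lemma objective_eq:
  "objective A b q a0 \<alpha> x = (if x \<in> feasible \<alpha> then ereal (quadratic A b q a0 x) else \<infinity>)"
proof (cases "x \<in> feasible \<alpha>")
  case True
  then have "(\<Sum>i\<in>UNIV. indicator_fun (cball 0 \<alpha>) (block x i)) = 0"
    by (intro sum.neutral) (auto simp: indicator_fun_def feasible_def)
  with True show ?thesis by (simp add: objective_def quadratic_def)
next
  case False
  then have "(\<Sum>i\<in>UNIV. indicator_fun (cball 0 \<alpha>) (block x i)) = \<infinity>"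
    by (auto simp: sum_Pinfty indicator_fun_def feasible_def)
  with False show ?thesis by (simp add: objective_def)
qed

text \<open>The Taylor expansion of a quadratic function stops at second order; \<open>g\<close> is
  the gradient at \<open>x\<close>.\<close>

lemma quadratic_expand:
  fixes A :: "real ^ ('m::finite \<times> 2) ^ 'm"
  assumes "g = transpose A *v (A *v x - b) + q"
  shows "quadratic A b q a0 (x + d) = quadratic A b q a0 x + g \<bullet> d + 1/2 * (norm (A *v d))\<^sup>2"
proof -
  have "(transpose A *v (A *v x - b)) \<bullet> d = (A *v x - b) \<bullet> (A *v d)"
    by (simp add: dot_lmul_matrix)
  moreover have Ad: "A *v (x + d) - b = (A *v x - b) + A *v d"
    by (simp add: matrix_vector_right_distrib)
  moreover have "(norm (u + w))\<^sup>2 = (norm u)\<^sup>2 + 2 * (u \<bullet> w) + (norm w)\<^sup>2" for u w :: "real ^ 'm"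
    by (simp add: power2_norm_eq_inner inner_add_left inner_add_right inner_commute)
  ultimately show ?thesis
    unfolding quadratic_def assms Ad
    by (simp add: inner_add_left inner_add_right del: transpose_matrix_vector)
qed

text \<open>Block \<open>i\<close> can move freely a little. Moving it along the negative gradient
  would lower the value at first order, and the second-order term cannot compensate for small
  steps.\<close>

lemma min_imp_gradient_block_eq_0:
  fixes x :: "real ^ ('m::finite \<times> 2)"
  assumes g: "g = transpose A *v (A *v x - b) + q"
    and x: "x \<in> feasible \<alpha>" and min: "\<And>y. y \<in> feasible \<alpha> \<Longrightarrow> quadratic A b q a0 x \<le> quadratic A b q a0 y"
    and i: "norm (block x i) < \<alpha>"
  shows "block g i = 0"
proof (rule ccontr)
  assume "block g i \<noteq> 0"
  then have pos: "(norm (block g i))\<^sup>2 > 0" (is "?r > 0") by simp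
  \<comment> \<open>Only block \<open>i\<close> moves, so only its ball constraint has to be checked
    again.\<close>
  define d :: "real ^ ('m \<times> 2)" where "d = (\<chi> k. if fst k = i then - g $ k else 0)"
  have d: "block d j = (if j = i then - block g i else 0)" for j
    by (simp add: d_def block_def vec_eq_iff)
  have gd: "g \<bullet> d = - ?r"
    by (simp add: inner_eq_sum_block[of g] d if_distrib power2_norm_eq_inner cong: if_cong)
  have "((\<lambda>t. norm (block x i + t *\<^sub>R block d i)) \<longlongrightarrow> norm (block x i + 0 *\<^sub>R block d i)) (at_right 0)"
    by (intro tendsto_intros)
  then have "\<forall>\<^sub>F t in at_right 0. norm (block x i + t *\<^sub>R block d i) < \<alpha>"
    using i by (auto dest!: order_tendstoD(2))
  \<comment> \<open>For t > 0 this expression is the difference quotient of \<open>quadratic\<close>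
    at \<open>x\<close> along \<open>d\<close>; its limit is negative.\<close>
  moreover have "((\<lambda>t. - ?r + t * (1/2 * (norm (A *v d))\<^sup>2)) \<longlongrightarrow>
      - ?r + 0 * (1/2 * (norm (A *v d))\<^sup>2)) (at_right 0)"
    by (intro tendsto_intros)
  then have "\<forall>\<^sub>F t in at_right 0. - ?r + t * (1/2 * (norm (A *v d))\<^sup>2) < 0"
    by (rule order_tendstoD(2)) (use pos in simp)
  moreover have "\<forall>\<^sub>F t in at_right (0::real). t > 0"
    by (rule eventually_at_right_less)
  ultimately have "\<forall>\<^sub>F t in at_right (0::real). norm (block x i + t *\<^sub>R block d i) < \<alpha> \<and>
      - ?r + t * (1/2 * (norm (A *v d))\<^sup>2) < 0 \<and> t > 0"
    by eventually_elim simp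
  then obtain t where t: "norm (block x i + t *\<^sub>R block d i) < \<alpha>"
      "- ?r + t * (1/2 * (norm (A *v d))\<^sup>2) < 0" "t > 0"
    using eventually_happens' trivial_limit_at_right_real by blast
  have "norm (block (x + t *\<^sub>R d) j) \<le> \<alpha>" for j
    using x t(1) by (cases "j = i") (auto simp: feasible_def block_add block_scaleR d)
  then have "quadratic A b q a0 x \<le> quadratic A b q a0 (x + t *\<^sub>R d)"
    by (intro min) (simp add: feasible_def)
  then have "0 \<le> t * (- ?r + t * (1/2 * (norm (A *v d))\<^sup>2))"
    by (simp add: quadratic_expand[OF g] gd matrix_vector_mult_scaleR power2_eq_square algebra_simps)
  with t(2,3) show False by (simp add: zero_le_mult_iff)
qed

theorem theorem3:
  fixes A :: "real ^ ('m::finite \<times> 2) ^ 'm"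
    and b :: "real ^ 'm"
    and q lbar gbar :: "real ^ ('m \<times> 2)"
    and a0 \<alpha> :: real
  assumes "\<alpha> > 0"
    and "is_arg_min (objective A b q a0 \<alpha>) (\<lambda>_. True) lbar"
    and "gbar = transpose A *v (A *v lbar - b) + q"
    and "\<And>i. (block lbar i \<in> frontier (cball 0 \<alpha>) \<and> block gbar i \<noteq> 0 \<and>
                - block gbar i \<in> normal_cone (cball 0 \<alpha>) (block lbar i))
            \<or> block lbar i \<in> interior (cball 0 \<alpha>)"
  shows "metrically_subregular (subdifferential (objective A b q a0 \<alpha>)) lbar 0"
proof -
  let ?f = "objective A b q a0 \<alpha>" and ?h = "quadratic A b q a0"
  define I where "I = {i. norm (block lbar i) = \<alpha>}"
  have active: "block gbar i \<noteq> 0" "- block gbar i \<in> normal_cone (cball 0 \<alpha>) (block lbar i)"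
    if "i \<in> I" for i
    using assms(4)[of i] that by (auto simp: I_def)
  have inactive: "norm (block lbar i) < \<alpha>" if "i \<notin> I" for i
    using assms(4)[of i] that \<open>\<alpha> > 0\<close> by (auto simp: I_def)
  have feas: "lbar \<in> feasible \<alpha>"
    unfolding feasible_def using inactive by (force simp: I_def)
  have fbar: "?f lbar = ereal (?h lbar)" using feas by (simp add: objective_eq)
  have min: "?f lbar \<le> ?f y" for y
    using assms(2) by (simp add: is_arg_min_def not_less)
  have hmin: "?h lbar \<le> ?h y" if "y \<in> feasible \<alpha>" for y
    using min[of y] that feas by (simp add: objective_eq)
  have gbar0: "block gbar i = 0" if "i \<notin> I" for i
    using min_imp_gradient_block_eq_0[OF assms(3) feas hmin inactive[OF that]] .
  \<comment> \<open>The 1/2 is the coefficient of |A d|^2 in the expansion, the other entries are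
    the curvature constants of the active balls. The 1/2 also keeps the set nonempty when
    \<open>I\<close> is empty.\<close>
  define c where "c = Min (insert (1/2) ((\<lambda>i. norm (block gbar i) / (2 * \<alpha>)) ` I))"
  have c: "c > 0" "c \<le> 1/2" "\<And>i. i \<in> I \<Longrightarrow> c \<le> norm (block gbar i) / (2 * \<alpha>)"
    unfolding c_def using active(1) \<open>\<alpha> > 0\<close> by (simp, intro Min_le, auto)
  \<comment> \<open>The kernel of \<open>T\<close> consists of the directions that leave the active
    blocks fixed and satisfy A d = 0. As \<open>gbar\<close> vanishes on the inactive blocks, the
    quadratic part is constant along them from \<open>lbar\<close>.\<close>
  define T :: "real ^ ('m \<times> 2) \<Rightarrow> (real ^ 'm) \<times> (real ^ 2 ^ 'm)"
    where "T d = (A *v d, \<chi> i. if i \<in> I then block d i else 0)" for d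
  have "linear T"
    by (rule linearI) (auto simp: T_def vec_eq_iff block_add block_scaleR
        matrix_vector_right_distrib matrix_vector_mult_scaleR)
  then obtain s where s: "s > 0"
    "\<And>d. \<exists>k. T k = 0 \<and> norm k \<le> norm d \<and> s * norm (d - k) \<le> norm (T d)"
    by (rule linear_error_bound) blast
  have normT: "(norm (T d))\<^sup>2 = (norm (A *v d))\<^sup>2 + (\<Sum>i\<in>I. (norm (block d i))\<^sup>2)" for d
    by (simp add: T_def power2_norm_eq_inner inner_vec_def[of "vec_lambda _"] if_distrib
        sum.If_cases cong: if_cong)
  have ginner: "gbar \<bullet> d = (\<Sum>i\<in>I. block gbar i \<bullet> block d i)" for d
    unfolding inner_eq_sum_block[of gbar]
    by (rule sum.mono_neutral_right) (auto simp: gbar0)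
  \<comment> \<open>The linear term of the expansion controls the active blocks through the
    curvature of the ball, and the quadratic term controls A d.\<close>
  have growth: "?h lbar + c * (norm (T (x - lbar)))\<^sup>2 \<le> ?h x" if x: "x \<in> feasible \<alpha>" for x
  proof -
    have "c * (norm (block (x - lbar) i))\<^sup>2 \<le> block gbar i \<bullet> block (x - lbar) i" if "i \<in> I" for i
    proof -
      have "norm (block gbar i) / (2 * \<alpha>) * (norm (block x i - block lbar i))\<^sup>2
          \<le> block gbar i \<bullet> (block x i - block lbar i)"
        using that x \<open>\<alpha> > 0\<close>
        by (intro normal_cone_cball_growth active) (auto simp: I_def feasible_def)
      moreover have "c * (norm (block x i - block lbar i))\<^sup>2
          \<le> norm (block gbar i) / (2 * \<alpha>) * (norm (block x i - block lbar i))\<^sup>2"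
        by (intro mult_right_mono c that) auto
      ultimately show ?thesis by (simp add: block_diff)
    qed
    then have "c * (\<Sum>i\<in>I. (norm (block (x - lbar) i))\<^sup>2) \<le> gbar \<bullet> (x - lbar)"
      unfolding ginner sum_distrib_left by (rule sum_mono)
    moreover have "c * (norm (A *v (x - lbar)))\<^sup>2 \<le> 1/2 * (norm (A *v (x - lbar)))\<^sup>2"
      by (intro mult_right_mono c) auto
    ultimately show ?thesis
      using quadratic_expand[OF assms(3), of a0 "x - lbar"]
      by (simp add: normT distrib_left)
  qed
  \<comment> \<open>The radius is at most the smallest slack of the inactive constraints; the entry
    1 covers the case where all blocks are active.\<close>
  define e where "e = Min (insert 1 ((\<lambda>i. \<alpha> - norm (block lbar i)) ` (- I)))"
  have e: "e > 0" "\<And>i. i \<notin> I \<Longrightarrow> e \<le> \<alpha> - norm (block lbar i)"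
    unfolding e_def using inactive by (auto intro: Min_le simp del: Min_insert)
  have "\<exists>p. ?f p = ?f lbar \<and> ?f lbar + ereal (c * s\<^sup>2 * (dist x p)\<^sup>2) \<le> ?f x"
    if x: "dist lbar x < e" for x
  proof -
    \<comment> \<open>The minimizer to compare with is \<open>lbar + k\<close>: the kernel direction
      \<open>k\<close> approximates x - lbar up to an error controlled by \<open>T\<close>.\<close>
    obtain k where k: "T k = 0" "norm k \<le> norm (x - lbar)"
      "s * norm ((x - lbar) - k) \<le> norm (T (x - lbar))"
      using s(2) by blast
    have Ak: "A *v k = 0" using k(1) by (simp add: T_def zero_prod_def)
    have kI: "block k i = 0" if "i \<in> I" for i
      using k(1) that by (auto simp: T_def zero_prod_def vec_eq_iff dest!: spec[of _ i])
    \<comment> \<open>Active blocks do not move, and the others move by less than their slack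
      because |k| \<le> |x - lbar| < e.\<close>
    have "norm (block (lbar + k) i) \<le> \<alpha>" for i
    proof (cases "i \<in> I")
      case True
      then show ?thesis using kI by (simp add: block_add I_def)
    next
      case False
      have "norm (block k i) < e"
        using norm_block_le[of k i] k(2) x by (simp add: dist_norm norm_minus_commute)
      then show ?thesis
        using e(2)[OF False] norm_triangle_ineq[of "block lbar i" "block k i"]
        by (simp add: block_add)
    qed
    then have "?f (lbar + k) = ereal (?h (lbar + k))"
      by (simp add: objective_eq feasible_def)
    also have "?h (lbar + k) = ?h lbar"
      by (simp add: quadratic_expand[OF assms(3)] Ak ginner kI)
    finally have "?f (lbar + k) = ?f lbar" using fbar by simp
    \<comment> \<open>At feasible \<open>x\<close>, the growth in terms of \<open>T\<close> combines
      with the linear error bound, which contributes the factor s^2. At infeasible \<open>x\<close>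
      the right-hand side is \<infinity>.\<close>
    moreover have "?f lbar + ereal (c * s\<^sup>2 * (dist x (lbar + k))\<^sup>2) \<le> ?f x"
    proof (cases "x \<in> feasible \<alpha>")
      case True
      have "(s * dist x (lbar + k))\<^sup>2 \<le> (norm (T (x - lbar)))\<^sup>2"
        using k(3) s(1) by (intro power_mono) (auto simp: dist_norm diff_diff_eq)
      then have "c * s\<^sup>2 * (dist x (lbar + k))\<^sup>2 \<le> c * (norm (T (x - lbar)))\<^sup>2"
        using c(1) by (simp add: power_mult_distrib mult.assoc)
      then show ?thesis using growth[OF True] fbar True by (simp add: objective_eq)
    qed (simp add: objective_eq)
    ultimately show ?thesis by blast
  qed
  then show ?thesis
    using c(1) s(1) e(1) fbar min
    by (intro quadratic_growth_imp_metrically_subregular[where c = "c * s\<^sup>2" and e = e]) auto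
qed

end
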